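(* Let $h$ be a non-constant polynomial in $\mathbb{C}^n$ and let $f=e^h$. Then $\rho(f)=\mu(f)=\deg(h)$.
   Context: For an entire function $f$ on $\mathbb{C}^n$, the Nevanlinna characteristic is $T(r,f)=\int_{\|z\|=r}\log^+|f|\,\sigma$, where $\sigma=d^c\log\|z\|^2\wedge(dd^c\log\|z\|^2)^{n-1}$ and $d^c=\frac{i}{4\pi}(\bar\partial-\partial)$. The order and the lower order of $f$ are $\rho(f)=\limsup_{r\to\infty}\frac{\log^+T(r,f)}{\log r}$ and $\mu(f)=\liminf_{r\to\infty}\frac{\log^+T(r,f)}{\log r}$. Here $\deg(h)$ is the total degree. *)

theory Defs
  imports "HOL-Analysis.Analysis" "HOL-Library.Poly_Mapping" "HOL-Combinatorics.Permutations"
begin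

section \<open>Polynomials on the space of complex n-tuples\<close>

text \<open>
  A polynomial in the variables indexed by \<open>'n\<close> is a finitely supported map from exponent
  vectors to coefficients.
\<close>

type_synonym 'n cpoly = "('n \<Rightarrow>\<^sub>0 nat) \<Rightarrow>\<^sub>0 complex"

definition poly_fun :: "('n::finite) cpoly \<Rightarrow> complex ^ 'n \<Rightarrow> complex" where
  "poly_fun p z =
     (\<Sum>m\<in>Poly_Mapping.keys p.
        Poly_Mapping.lookup p m * (\<Prod>j\<in>UNIV. (z $ j) ^ Poly_Mapping.lookup m j))"

text \<open>The zero polynomial gets total degree 0.\<close>

definition total_degree :: "('n::finite) cpoly \<Rightarrow> nat" where
  "total_degree p =
     Max (insert 0 ((\<lambda>m. \<Sum>j\<in>UNIV. Poly_Mapping.lookup m j) ` Poly_Mapping.keys p))"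

definition constant_poly :: "('n::finite) cpoly \<Rightarrow> bool" where
  "constant_poly p \<longleftrightarrow> (\<exists>c. p = Poly_Mapping.single 0 c)"


section \<open>Differential forms\<close>

text \<open>
  A complex-valued form of degree \<open>k\<close> takes a base point and a sequence of real tangent
  vectors, of which only the entries \<open>0, \<dots>, k - 1\<close> matter.  The wedge product and the exterior
  derivative are normalised so that \<open>dx\<^sub>1 \<and> \<dots> \<and> dx\<^sub>k\<close> takes the value 1 on
  \<open>(e\<^sub>1, \<dots>, e\<^sub>k)\<close>.
\<close>

type_synonym 'v cform = "'v \<Rightarrow> (nat \<Rightarrow> 'v) \<Rightarrow> complex"

definition wedge :: "nat \<Rightarrow> nat \<Rightarrow> 'v cform \<Rightarrow> 'v cform \<Rightarrow> 'v cform" where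
  "wedge k l \<alpha> \<beta> = (\<lambda>z v.
     (\<Sum>\<pi> | \<pi> permutes {..<k + l}.
        of_int (sign \<pi>) * \<alpha> z (\<lambda>j. v (\<pi> j)) * \<beta> z (\<lambda>j. v (\<pi> (k + j))))
     / (fact k * fact l))"

primrec wedge_power :: "nat \<Rightarrow> 'v cform \<Rightarrow> nat \<Rightarrow> 'v cform" where
  "wedge_power k \<omega> 0 = (\<lambda>z v. 1)"
| "wedge_power k \<omega> (Suc m) = wedge k (k * m) \<omega> (wedge_power k \<omega> m)"

text \<open>The vectors are extended to constant vector fields, so no Lie bracket terms appear.\<close>

definition ext_deriv :: "nat \<Rightarrow> ('v::real_normed_vector) cform \<Rightarrow> 'v cform" where
  "ext_deriv k \<omega> = (\<lambda>z v.
     \<Sum>i\<le>k. (- 1) ^ i *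
       frechet_derivative (\<lambda>w. \<omega> w (\<lambda>j. if j < i then v j else v (Suc j))) (at z) (v i))"

text \<open>
  \<open>\<partial>u\<close> and \<open>\<partial>\<close>-bar \<open>u\<close> are the complex-linear and the complex-antilinear part of the real
  differential \<open>du\<close>.
\<close>

definition del :: "(complex ^ 'n \<Rightarrow> complex) \<Rightarrow> (complex ^ 'n) cform" where
  "del u = (\<lambda>z v. (frechet_derivative u (at z) (v 0)
                    - \<i> * frechet_derivative u (at z) (\<i> *s v 0)) / 2)"

definition delbar :: "(complex ^ 'n \<Rightarrow> complex) \<Rightarrow> (complex ^ 'n) cform" where
  "delbar u = (\<lambda>z v. (frechet_derivative u (at z) (v 0)
                       + \<i> * frechet_derivative u (at z) (\<i> *s v 0)) / 2)"

definition dc :: "(complex ^ 'n \<Rightarrow> complex) \<Rightarrow> (complex ^ 'n) cform" where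
  "dc u = (\<lambda>z v. \<i> / (4 * of_real pi) * (delbar u z v - del u z v))"

definition log_norm_sq :: "complex ^ 'n \<Rightarrow> complex" where
  "log_norm_sq z = of_real (ln ((norm z)\<^sup>2))"

definition sigma_form :: "(complex ^ 'n) cform" where
  "sigma_form =
     wedge 1 (2 * (CARD('n) - 1)) (dc log_norm_sq)
       (wedge_power 2 (ext_deriv 1 (dc log_norm_sq)) (CARD('n) - 1))"


section \<open>Integration of forms over spheres\<close>

text \<open>
  Euclidean surface measure on the sphere of radius \<open>r > 0\<close> about the origin of a space of
  real dimension \<open>d\<close>: the surface measure of \<open>A\<close> is \<open>d / r\<close> times the volume of the cone over
  \<open>A\<close> with apex 0.  The origin, where the radial projection is not defined, is a null set.
\<close>

definition sphere_measure :: "real \<Rightarrow> ('a::euclidean_space) measure" where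
  "sphere_measure r =
     scale_measure (ennreal (real DIM('a) / r))
       (distr (restrict_space lborel (cball 0 r)) borel (\<lambda>x. (r / norm x) *\<^sub>R x))"

text \<open>
  The real frame \<open>(b\<^sub>0, i b\<^sub>0, b\<^sub>1, i b\<^sub>1, \<dots>)\<close> attached to complex vectors \<open>b\<^sub>0, b\<^sub>1, \<dots>\<close>.
  When \<open>b\<close> is a complex basis, this frame is positive for the complex orientation.
\<close>

definition real_frame :: "(nat \<Rightarrow> complex ^ 'n) \<Rightarrow> nat \<Rightarrow> complex ^ 'n" where
  "real_frame b k = (if even k then b (k div 2) else \<i> *s b (k div 2))"

definition adapted_basis :: "complex ^ 'n \<Rightarrow> (nat \<Rightarrow> complex ^ 'n) \<Rightarrow> bool" where
  "adapted_basis z b \<longleftrightarrow>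
     b 0 = z /\<^sub>R norm z \<and>
     (\<forall>k < 2 * CARD('n). \<forall>l < 2 * CARD('n).
        real_frame b k \<bullet> real_frame b l = (if k = l then 1 else 0))"

text \<open>
  Dropping the outward unit normal \<open>b\<^sub>0\<close> from the real frame of an adapted basis leaves a
  positively oriented orthonormal basis of the tangent space of the sphere at \<open>z\<close>.  An
  alternating form of top degree takes the same value on all such bases, so the choice below
  does not matter.
\<close>

definition tangent_frame :: "complex ^ 'n \<Rightarrow> nat \<Rightarrow> complex ^ 'n" where
  "tangent_frame z = (\<lambda>j. real_frame (SOME b. adapted_basis z b) (Suc j))"

definition sphere_integral :: "real \<Rightarrow> (complex ^ 'n) cform \<Rightarrow> complex" where
  "sphere_integral r \<eta> = (LINT z|sphere_measure r. \<eta> z (tangent_frame z))"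


section \<open>Characteristic, order and lower order\<close>

definition log_plus :: "real \<Rightarrow> real" where
  "log_plus x = ln (max 1 x)"

text \<open>Since \<open>\<sigma>\<close> is a real form, taking the real part only changes the type.\<close>

definition nev_char :: "real \<Rightarrow> (complex ^ 'n \<Rightarrow> complex) \<Rightarrow> real" where
  "nev_char r f =
     Re (sphere_integral r (\<lambda>z v. of_real (log_plus (norm (f z))) * sigma_form z v))"

definition nev_order :: "(complex ^ 'n \<Rightarrow> complex) \<Rightarrow> ereal" where
  "nev_order f = Limsup at_top (\<lambda>r. ereal (log_plus (nev_char r f) / ln r))"

definition nev_lower_order :: "(complex ^ 'n \<Rightarrow> complex) \<Rightarrow> ereal" where
  "nev_lower_order f = Liminf at_top (\<lambda>r. ereal (log_plus (nev_char r f) / ln r))"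

end

(* On the tangent frame of the sphere of radius r, the form sigma is a positive constant times
   r^(1 - 2n), so T(r, f) is a positive constant times the integral of log^+ |f(r y / |y|)| over
   the unit ball.  For f = e^h with d = deg h the integrand is max(0, Re h).  It is O(r^d); and
   since the leading form h_d is homogeneous and not identically zero, rotating the argument makes
   Re h_d positive on a nonempty open cone, on which Re h grows like r^d.  Hence T(r, f) lies
   between two positive multiples of r^d. *)

theory Submission
  imports Defs
begin

section \<open>Wedge products on index sequences\<close>

text \<open>The tangent frame comes from a choice operator, so only orthonormality and
  \<open>b 0 = z /\<^sub>R norm z\<close> are known about it. The evaluation of sigma is therefore
  moved from vectors to indices: on frame vectors, d^c log|z|^2 becomes 1/(2 pi r) times the
  covector dual to the direction i z, and dd^c log|z|^2 becomes 1/(pi r^2) times a fixed skew matrix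
  on indices. What remains is a combinatorial constant depending on n alone. Its positivity is the
  delicate point, since a wedge power is a signed sum over permutations and could cancel. Positivity
  suffices, because a factor c > 0 contributes only ln c / ln r to the quotient defining the order.
  The surface measure is given by cone volumes, so sphere integrals become volume integrals of
  functions constant along rays, and a nonempty open cone contributes a positive amount.\<close>

text \<open>A wedge product only permutes slots, so a comparison of the factors through a frame
  \<open>e\<close> survives, with scalars multiplied. On the right-hand side the indices themselves
  act as tangent vectors. The set \<open>S\<close> records the indices for which the comparison is
  valid; permuting slots does not leave it.\<close>

lemma wedge_pullback:
  assumes \<alpha>: "\<And>s. (\<forall>j<k. s j \<in> S) \<Longrightarrow> \<alpha> z (\<lambda>j. e (s j)) = a * \<alpha>' z' s"
    and \<beta>: "\<And>s. (\<forall>j<l. s j \<in> S) \<Longrightarrow> \<beta> z (\<lambda>j. e (s j)) = b * \<beta>' z' s"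
    and s: "\<forall>j<k + l. s j \<in> S"
  shows "wedge k l \<alpha> \<beta> z (\<lambda>j. e (s j)) = a * b * wedge k l \<alpha>' \<beta>' z' s"
proof -
  have "\<alpha> z (\<lambda>j. e (s (\<pi> j))) = a * \<alpha>' z' (\<lambda>j. s (\<pi> j))"
       "\<beta> z (\<lambda>j. e (s (\<pi> (k + j)))) = b * \<beta>' z' (\<lambda>j. s (\<pi> (k + j)))"
    if "\<pi> permutes {..<k + l}" for \<pi>
  proof -
    have m: "\<pi> j < k + l" if "j < k + l" for j
      using permutes_in_image[OF \<open>\<pi> permutes _\<close>, of j] that by simp
    show "\<alpha> z (\<lambda>j. e (s (\<pi> j))) = a * \<alpha>' z' (\<lambda>j. s (\<pi> j))"
      using s m by (intro \<alpha>) auto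
    show "\<beta> z (\<lambda>j. e (s (\<pi> (k + j)))) = b * \<beta>' z' (\<lambda>j. s (\<pi> (k + j)))"
      using s m by (intro \<beta>) auto
  qed
  then show ?thesis
    unfolding wedge_def sum_distrib_left times_divide_eq_right
    by (intro arg_cong2[where f="(/)"] sum.cong refl) (auto simp: mult_ac)
qed

lemma wedge_power_pullback:
  assumes "\<And>s. (\<forall>j<k. s j \<in> S) \<Longrightarrow> \<omega> z (\<lambda>j. e (s j)) = c * \<omega>' z' s"
    and "\<forall>j<k * m. s j \<in> S"
  shows "wedge_power k \<omega> m z (\<lambda>j. e (s j)) = c ^ m * wedge_power k \<omega>' m z' s"
  using assms(2)
proof (induction m arbitrary: s)
  case (Suc m)
  have "wedge k (k * m) \<omega> (wedge_power k \<omega> m) z (\<lambda>j. e (s j))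
      = c * c ^ m * wedge k (k * m) \<omega>' (wedge_power k \<omega>' m) z' s"
    by (rule wedge_pullback[where S=S]) (use assms(1) Suc in auto)
  then show ?case by simp
qed simp

text \<open>The sum over all permutations does the antisymmetrising: composing with \<open>p\<close>
  on the left reindexes it and pulls out the sign.\<close>

lemma wedge_permute:
  assumes "p permutes {..<k + l}"
  shows "wedge k l \<alpha> \<beta> z (\<lambda>j. s (p j)) = of_int (sign p) * wedge k l \<alpha> \<beta> z s"
proof -
  let ?P = "{\<pi>. \<pi> permutes {..<k + l}}"
  let ?f = "\<lambda>\<pi>. of_int (sign \<pi>) * \<alpha> z (\<lambda>j. s (\<pi> j)) * \<beta> z (\<lambda>j. s (\<pi> (k + j)))"
  have sign: "sign (p \<circ> \<pi>) = sign p * sign \<pi>" if "\<pi> permutes {..<k + l}" for \<pi>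
    by (rule sign_compose) (use assms that permutation_permutes in blast)+
  have "(\<Sum>\<pi>\<in>?P. ?f \<pi>) = (\<Sum>\<pi>\<in>?P. ?f (p \<circ> \<pi>))"
    by (rule setum_permutations_compose_left[OF assms])
  also have "\<dots> = (\<Sum>\<pi>\<in>?P. of_int (sign p) *
      (of_int (sign \<pi>) * \<alpha> z (\<lambda>j. s (p (\<pi> j))) * \<beta> z (\<lambda>j. s (p (\<pi> (k + j))))))"
    by (intro sum.cong refl) (simp add: sign mult.assoc)
  finally have "(\<Sum>\<pi>\<in>?P. ?f \<pi>) = \<dots>" .
  then have "of_int (sign p) * (\<Sum>\<pi>\<in>?P. ?f \<pi>) = (of_int (sign p) * of_int (sign p)) *
     (\<Sum>\<pi>\<in>?P. of_int (sign \<pi>) * \<alpha> z (\<lambda>j. s (p (\<pi> j))) * \<beta> z (\<lambda>j. s (p (\<pi> (k + j)))))"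
    by (simp add: sum_distrib_left[symmetric] mult.assoc)
  also have "(of_int (sign p) * of_int (sign p) :: complex) = 1"
    by (simp flip: of_int_mult)
  finally show ?thesis
    unfolding wedge_def by simp
qed

lemma wedge_power_permute:
  assumes "p permutes {..<k * m}"
  shows "wedge_power k \<omega> m z (\<lambda>j. s (p j)) = of_int (sign p) * wedge_power k \<omega> m z s"
proof (cases m)
  case 0
  then show ?thesis using assms by simp
next
  case (Suc m')
  then show ?thesis using assms by (simp add: wedge_permute)
qed

text \<open>Antisymmetry of a wedge power concerns permutations of an initial segment. Conjugating
  by a shift brings a permutation of the remaining slots into that shape, with the same
  sign.\<close>

lemma permutes_fixing_initial_segment:
  fixes k N :: nat
  assumes p: "p permutes {..<k + N}" and fixed: "\<forall>j<k. p j = j"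
  obtains q where "q permutes {..<N}" "sign q = sign p" "\<And>j. j < N \<Longrightarrow> p (k + j) = k + q j"
proof -
  let ?A = "{k..<k + N}"
  have pA: "p permutes ?A"
    by (rule permutes_superset[OF p]) (use fixed in auto)
  have inj: "inj_on (\<lambda>x. x - k) ?A" by (auto simp: inj_on_def)
  have bij: "bij_betw (\<lambda>x. x - k) ?A {..<N}"
    by (rule bij_betwI[where g="\<lambda>x. x + k"]) auto
  let ?q = "map_permutation ?A (\<lambda>x. x - k) p"
  have "k + ?q j = p (k + j)" if "j < N" for j
  proof -
    have "?q ((k + j) - k) = p (k + j) - k"
      by (rule map_permutation_apply) (use inj that in auto)
    moreover have "p (k + j) \<ge> k"
      using permutes_in_image[OF pA, of "k + j"] that by auto
    ultimately show ?thesis by simp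
  qed
  then show thesis
    using map_permutation_permutes[OF bij pA] sign_map_permutation[OF inj pA]
    by (intro that[of ?q]) auto
qed

lemma wedge_power_cong:
  fixes s s' :: "nat \<Rightarrow> 'v"
  assumes "\<And>s s'. \<forall>j<k. s j = s' j \<Longrightarrow> \<omega> z s = \<omega> z s'" "\<And>j. j < k * m \<Longrightarrow> s j = s' j"
  shows "wedge_power k \<omega> m z s = wedge_power k \<omega> m z s'"
proof -
  have "\<forall>s s' :: nat \<Rightarrow> 'v. (\<forall>j<k * m. s j = s' j) \<longrightarrow> wedge_power k \<omega> m z s = wedge_power k \<omega> m z s'"
  proof (induction m)
    case (Suc m)
    show ?case
    proof (intro allI impI)
      fix s s' :: "nat \<Rightarrow> 'v" assume *: "\<forall>j<k * Suc m. s j = s' j"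
      have "\<omega> z (\<lambda>j. s (\<pi> j)) = \<omega> z (\<lambda>j. s' (\<pi> j))"
        "wedge_power k \<omega> m z (\<lambda>j. s (\<pi> (k + j))) = wedge_power k \<omega> m z (\<lambda>j. s' (\<pi> (k + j)))"
        if "\<pi> permutes {..<k + k * m}" for \<pi>
      proof -
        have m: "\<pi> j < k + k * m" if "j < k + k * m" for j
          using permutes_in_image[OF \<open>\<pi> permutes _\<close>, of j] that by simp
        show "\<omega> z (\<lambda>j. s (\<pi> j)) = \<omega> z (\<lambda>j. s' (\<pi> j))"
          using * m by (intro assms(1)) auto
        show "wedge_power k \<omega> m z (\<lambda>j. s (\<pi> (k + j))) = wedge_power k \<omega> m z (\<lambda>j. s' (\<pi> (k + j)))"
          using * m by (intro Suc.IH[rule_format]) auto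
      qed
      then show "wedge_power k \<omega> (Suc m) z s = wedge_power k \<omega> (Suc m) z s'"
        by (simp add: wedge_def)
    qed
  qed simp
  then show ?thesis using assms(2) by blast
qed

text \<open>
  The standard symplectic form on indices: the values \<open>\<langle>i e\<^sub>k, e\<^sub>l\<rangle>\<close> for a real frame
  \<open>e = (b\<^sub>0, i b\<^sub>0, b\<^sub>1, i b\<^sub>1, \<dots>)\<close>.
\<close>

definition pairing :: "nat cform" where
  "pairing z s = (if even (s 0) \<and> s 1 = Suc (s 0) then 1
                  else if even (s 1) \<and> s 0 = Suc (s 1) then - 1 else 0)"

section \<open>Positivity of the powers of the standard symplectic form\<close>

text \<open>The first two values of \<open>p\<close> form a block {a, a+1} with a even. Exchanging
  this block with {0, 1} is an even permutation and respects all blocks. If \<open>p\<close> lists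
  its block in reverse, one more transposition is needed, and its sign is exactly the value -1 of
  the pairing.\<close>

lemma pairing_frame:
  assumes p: "p permutes {..<2 + N}" and nz: "pairing z p \<noteq> 0"
  obtains g where "g permutes {..<2 + N}" "g 0 = p 0" "g 1 = p 1" "pairing z p = of_int (sign g)"
    "\<And>s. \<forall>j<2. s j \<ge> 2 \<Longrightarrow> pairing z (\<lambda>j. g (s j)) = pairing z s"
proof -
  define a where "a = min (p 0) (p 1)"
  have lt: "p 0 < 2 + N" "p 1 < 2 + N"
    using permutes_in_image[OF p, of 0] permutes_in_image[OF p, of 1] by auto
  have cases: "p 1 = Suc (p 0) \<and> even (p 0) \<or> p 0 = Suc (p 1) \<and> even (p 1)"
    using nz unfolding pairing_def by presburger
  then have a: "even a" "Suc a < 2 + N"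
    using lt by (auto simp: a_def)
  \<comment> \<open>The exchange of the two blocks; it degenerates to the identity when
    \<open>a = 0\<close>, so its sign is 1 in either case.\<close>
  define \<sigma> where "\<sigma> = Transposition.transpose 0 a \<circ> Transposition.transpose 1 (Suc a)"
  have perm: "permutation (Transposition.transpose x y)" for x y :: nat
    by (rule permutation_swap_id)
  have t: "Transposition.transpose x y permutes {..<2 + N}" if "x < 2 + N" "y < 2 + N" for x y
    using that by (intro permutes_swap_id) auto
  have \<sigma>: "\<sigma> permutes {..<2 + N}"
    unfolding \<sigma>_def by (intro permutes_compose t) (use a in auto)
  have permutation_\<sigma>: "permutation \<sigma>"
    using \<sigma> permutation_permutes by blast
  have sign_\<sigma>: "sign \<sigma> = 1"
    unfolding \<sigma>_def by (simp add: sign_compose perm sign_swap_id)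
  have \<sigma>0: "\<sigma> 0 = a" "\<sigma> 1 = Suc a"
    using a by (auto simp: \<sigma>_def Transposition.transpose_def)
  have \<sigma>_pair: "pairing z (\<lambda>j. \<sigma> (s j)) = pairing z s" if "\<forall>j<2. s j \<ge> 2" for s
  proof -
    have \<sigma>_eq: "\<sigma> x = (if x = a then 0 else if x = Suc a then 1 else x)" if "x \<ge> 2" for x
      using that a by (cases "a = 0") (auto simp: \<sigma>_def Transposition.transpose_def)
    have ev: "even (\<sigma> x) \<longleftrightarrow> even x" if "x \<ge> 2" for x
      using a by (simp add: \<sigma>_eq[OF that])
    have suc: "\<sigma> y = Suc (\<sigma> x) \<longleftrightarrow> y = Suc x" if "even x" "x \<ge> 2" "y \<ge> 2" for x y
      unfolding \<sigma>_eq[OF that(2)] \<sigma>_eq[OF that(3)] using a that by presburger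
    have "s 0 \<ge> 2" "s 1 \<ge> 2" using that by auto
    then show ?thesis by (simp add: pairing_def ev suc cong: conj_cong)
  qed
  from cases show thesis
  proof (elim disjE conjE)
    assume *: "p 1 = Suc (p 0)" "even (p 0)"
    have 1: "p 0 = a" "p 1 = Suc a" "pairing z p = 1"
      using * by (simp_all add: a_def pairing_def)
    then show ?thesis using \<sigma> \<sigma>0 sign_\<sigma> \<sigma>_pair by (intro that[of \<sigma>]) auto
  next
    assume *: "p 0 = Suc (p 1)" "even (p 1)"
    have 2: "p 1 = a" "p 0 = Suc a" "pairing z p = - 1"
      unfolding pairing_def using * by (simp_all add: a_def)
    \<comment> \<open>The transposition acts first, so it reverses the order inside the initial
      block and leaves every index from 2 on alone.\<close>
    let ?g = "\<sigma> \<circ> Transposition.transpose 0 1"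
    have "?g permutes {..<2 + N}" by (intro permutes_compose t \<sigma>) auto
    moreover have "sign ?g = - 1"
      using sign_compose[OF permutation_\<sigma> perm[of 0 1]] by (simp add: sign_\<sigma> sign_swap_id)
    moreover have "pairing z (\<lambda>j. ?g (s j)) = pairing z s" if "\<forall>j<2. s j \<ge> 2" for s
    proof -
      have "s 0 \<ge> 2" "s 1 \<ge> 2" using that by auto
      then have "Transposition.transpose 0 1 (s 0) = s 0" "Transposition.transpose 0 1 (s 1) = s 1"
        by (auto simp: Transposition.transpose_def)
      then have "pairing z (\<lambda>j. ?g (s j)) = pairing z (\<lambda>j. \<sigma> (s j))"
        by (simp add: pairing_def)
      then show ?thesis using \<sigma>_pair[OF that] by simp
    qed
    ultimately show ?thesis using 2 \<sigma>0 by (intro that[of ?g]) auto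
  qed
qed

lemma wedge_power_pairing_cong:
  assumes "\<And>j. j < 2 * m \<Longrightarrow> s j = s' j"
  shows "wedge_power 2 pairing m z s = wedge_power 2 pairing m z s'"
  by (rule wedge_power_cong) (use assms in \<open>auto simp: pairing_def\<close>)

lemma wedge_power_pairing_shift:
  assumes "even k"
  shows "wedge_power 2 pairing m z (\<lambda>j. k + s j) = wedge_power 2 pairing m z s"
proof -
  have "wedge_power 2 pairing m z (\<lambda>j. k + s j) = 1 ^ m * wedge_power 2 pairing m z s"
    by (rule wedge_power_pullback[where S=UNIV]) (use assms in \<open>simp_all add: pairing_def\<close>)
  then show ?thesis by simp
qed

text \<open>This counts instead of computing: if all nonzero terms agree, the sum is a multiple of
  their common value, and the witness \<open>a0\<close> makes the multiplicity positive.\<close>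

lemma sum_two_values:
  fixes x :: complex
  assumes "finite A" "\<And>a. a \<in> A \<Longrightarrow> f a = 0 \<or> f a = x" "a0 \<in> A" "f a0 = x"
  obtains k :: nat where "k > 0" "sum f A = of_nat k * x"
proof -
  let ?B = "{a \<in> A. f a = x}"
  have "sum f A = sum f ?B"
    using assms by (intro sum.mono_neutral_right) auto
  also have "\<dots> = of_nat (card ?B) * x" by simp
  finally show ?thesis
    using assms by (intro that[of "card ?B"]) (auto simp: card_gt_0_iff)
qed

text \<open>
  In the expansion of the power, a permutation whose first two values form a symplectic pair is the
  composition of a permutation preserving the pairing and one fixing the first two indices, so
  every nonzero summand equals the value of the previous power, and no cancellation occurs.
\<close>

lemma wedge_power_pairing_pos:
  obtains c :: real where "c > 0" "wedge_power 2 pairing m z (\<lambda>j. j) = of_real c"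
proof -
  have "\<exists>c::real. c > 0 \<and> wedge_power 2 pairing m z (\<lambda>j. j) = of_real c"
  proof (induction m)
    case 0
    show ?case by (intro exI[of _ 1]) simp
  next
    case (Suc m)
    then obtain c :: real where c: "c > 0" "wedge_power 2 pairing m z (\<lambda>j. j) = of_real c" by blast
    let ?W = "wedge_power 2 pairing m z"
    let ?P = "{\<pi>. \<pi> permutes {..<2 + 2 * m}}"
    let ?f = "\<lambda>\<pi>. of_int (sign \<pi>) * pairing z \<pi> * ?W (\<lambda>j. \<pi> (2 + j))"
    have "?f \<pi> = of_real c" if \<pi>: "\<pi> permutes {..<2 + 2 * m}" and nz: "pairing z \<pi> \<noteq> 0" for \<pi>
    proof -
      obtain g where g: "g permutes {..<2 + 2 * m}" "g 0 = \<pi> 0" "g 1 = \<pi> 1"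
        "pairing z \<pi> = of_int (sign g)"
        "\<And>s. \<forall>j<2. s j \<ge> 2 \<Longrightarrow> pairing z (\<lambda>j. g (s j)) = pairing z s"
        using pairing_frame[OF \<pi> nz] by metis
      \<comment> \<open>Since \<open>g\<close> agrees with \<open>\<pi>\<close> at 0 and 1, dividing
        it off leaves a permutation that fixes these two slots.\<close>
      define p where "p = inv g \<circ> \<pi>"
      have p: "p permutes {..<2 + 2 * m}"
        unfolding p_def by (intro permutes_compose \<pi> permutes_inv g)
      have gp: "g (p j) = \<pi> j" for j
        unfolding p_def using permutes_inverses(1)[OF g(1)] by simp
      have pfix: "\<forall>j<2. p j = j"
      proof (intro allI impI)
        fix j :: nat assume "j < 2"
        then have "j = 0 \<or> j = 1" by auto
        then show "p j = j" unfolding p_def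
          using permutes_inverses(2)[OF g(1), of 0] permutes_inverses(2)[OF g(1), of 1] g(2,3)
          by (elim disjE) simp_all
      qed
      obtain q where q: "q permutes {..<2 * m}" "sign q = sign p"
        "\<And>j. j < 2 * m \<Longrightarrow> p (2 + j) = 2 + q j"
        using permutes_fixing_initial_segment[OF p pfix] by metis
      have "?W (\<lambda>j. \<pi> (2 + j)) = ?W (\<lambda>j. g (2 + q j))"
        by (rule wedge_power_pairing_cong) (metis gp q(3))
      also have "\<dots> = 1 ^ m * ?W (\<lambda>j. 2 + q j)"
        by (rule wedge_power_pullback[where S="{2..}"]) (simp_all add: g(5))
      also have "\<dots> = ?W (\<lambda>j. 2 + q j)" by simp
      also have "\<dots> = ?W q" by (rule wedge_power_pairing_shift) simp
      also have "\<dots> = of_int (sign q) * of_real c"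
        using wedge_power_permute[OF q(1), of pairing z "\<lambda>j. j"] c by simp
      finally have W: "?W (\<lambda>j. \<pi> (2 + j)) = of_int (sign p) * of_real c"
        by (simp add: q)
      have "\<pi> = g \<circ> p" using gp by auto
      then have "sign \<pi> = sign g * sign p"
        using sign_compose g(1) p permutation_permutes by (metis finite_lessThan)
      \<comment> \<open>The pairing contributes the sign of \<open>g\<close> and the previous power
        that of \<open>p\<close>; together with the sign of \<open>\<pi>\<close>, both occur
        squared.\<close>
      then have "?f \<pi> = of_int ((sign g * sign g) * (sign p * sign p)) * of_real c"
        unfolding W g(4) of_int_mult by (simp only: of_int_mult mult_ac)
      then show ?thesis by simp
    qed
    then have "?f \<pi> = 0 \<or> ?f \<pi> = of_real c" if "\<pi> \<in> ?P" for \<pi>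
      using that by fastforce
    moreover have "?f (\<lambda>j. j) = of_real c"
      using c wedge_power_pairing_shift[of 2 m z "\<lambda>j. j"] by (simp add: pairing_def)
    ultimately obtain k :: nat where k: "k > 0" "sum ?f ?P = of_nat k * of_real c"
      using sum_two_values[of ?P ?f "of_real c" "\<lambda>j. j"]
      by (auto simp: finite_permutations permutes_id[unfolded id_def])
    \<comment> \<open>The denominator is the normalisation \<open>fact 2 * fact (2 * m)\<close> in
      the definition of the wedge product.\<close>
    then show ?case using c
      by (intro exI[of _ "real k * c / (2 * fact (2 * m))"]) (simp add: wedge_def)
  qed
  then show thesis using that by blast
qed

text \<open>This is the index model of sigma on a tangent frame: \<open>Suc\<close> omits the radial
  index 0, and \<open>\<alpha>\<close> reads off index 1, the direction i z. Only permutations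
  fixing slot 0 survive, and the power is then evaluated on the indices from 2 on, which are an even
  shift of those from 0 on.\<close>

lemma wedge_dual_pairing_pos:
  assumes "\<And>s. \<alpha> z s = (if s 0 = 1 then 1 else 0)"
  obtains c :: real where "c > 0"
    "wedge 1 (2 * m) \<alpha> (wedge_power 2 pairing m) z Suc = of_real c"
proof -
  obtain c :: real where c: "c > 0" "wedge_power 2 pairing m z (\<lambda>j. j) = of_real c"
    by (rule wedge_power_pairing_pos)
  let ?W = "wedge_power 2 pairing m z"
  let ?P = "{\<pi>. \<pi> permutes {..<1 + 2 * m}}"
  let ?f = "\<lambda>\<pi>. of_int (sign \<pi>) * \<alpha> z (\<lambda>j. Suc (\<pi> j)) * ?W (\<lambda>j. Suc (\<pi> (1 + j)))"
  have "?f \<pi> = of_real c" if \<pi>: "\<pi> permutes {..<1 + 2 * m}" and fixed: "\<pi> 0 = 0" for \<pi>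
  proof -
    obtain q where q: "q permutes {..<2 * m}" "sign q = sign \<pi>"
      "\<And>j. j < 2 * m \<Longrightarrow> \<pi> (1 + j) = 1 + q j"
      using permutes_fixing_initial_segment[OF \<pi>] fixed by (metis less_one)
    have "?W (\<lambda>j. Suc (\<pi> (1 + j))) = ?W (\<lambda>j. 2 + q j)"
      by (rule wedge_power_pairing_cong) (use q(3) in simp)
    also have "\<dots> = ?W q" by (rule wedge_power_pairing_shift) simp
    also have "\<dots> = of_int (sign q) * of_real c"
      using wedge_power_permute[OF q(1), of pairing z "\<lambda>j. j"] c by simp
    finally have "?f \<pi> = of_int (sign \<pi> * sign \<pi>) * of_real c"
      unfolding of_int_mult using fixed assms by (simp add: q)
    then show ?thesis by simp
  qed
  then have "?f \<pi> = 0 \<or> ?f \<pi> = of_real c" if "\<pi> \<in> ?P" for \<pi>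
    using that assms by fastforce
  moreover have "?f (\<lambda>j. j) = of_real c"
    using c wedge_power_pairing_shift[of 2 m z "\<lambda>j. j"] by (simp add: assms)
  ultimately obtain k :: nat where k: "k > 0" "sum ?f ?P = of_nat k * of_real c"
    using sum_two_values[of ?P ?f "of_real c" "\<lambda>j. j"]
    by (auto simp: finite_permutations permutes_id[unfolded id_def])
  then show ?thesis using c
    by (intro that[of "real k * c / fact (2 * m)"]) (simp_all add: wedge_def)
qed

section \<open>The form sigma on tangent frames\<close>

lemma ii_smult: "\<i> *s (\<i> *s x) = - x"
  by (simp add: vec_eq_iff)

lemma inner_ii_skew: "(\<i> *s x) \<bullet> y = - (x \<bullet> (\<i> *s y))"
  by (simp add: inner_vec_def inner_complex_def sum_negf[symmetric] algebra_simps)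

lemma inner_ii_ii: "(\<i> *s x) \<bullet> (\<i> *s y) = x \<bullet> y"
  by (simp add: inner_ii_skew ii_smult)

lemma linear_ii: "bounded_linear (\<lambda>x :: complex ^ 'n::finite. \<i> *s x)"
  unfolding linear_conv_bounded_linear[symmetric]
  by (intro linearI) (auto simp: vec_eq_iff algebra_simps)

lemma has_derivative_log_norm_sq:
  assumes "z \<noteq> 0"
  shows "(log_norm_sq has_derivative (\<lambda>v. of_real (2 * (z \<bullet> v) / (z \<bullet> z)))) (at z)"
proof -
  have "((\<lambda>z. of_real (ln (z \<bullet> z)) :: complex) has_derivative
      (\<lambda>v. of_real (2 * (z \<bullet> v) / (z \<bullet> z)))) (at z)"
    using assms by (auto intro!: derivative_eq_intros simp: inner_commute field_simps)
  then show ?thesis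
    by (simp add: log_norm_sq_def[abs_def] power2_norm_eq_inner)
qed

text \<open>The difference \<open>delbar u - del u\<close> equals i times the differential applied
  to i v, hence d^c u (v) = - du(i v) / (4 pi). Skewness of multiplication by i then moves it onto
  z.\<close>

lemma dc_log_norm_sq:
  assumes "z \<noteq> 0"
  shows "dc log_norm_sq z v = of_real (((\<i> *s z) \<bullet> v 0) / (2 * pi * (z \<bullet> z)))"
proof -
  have D: "frechet_derivative log_norm_sq (at z) = (\<lambda>v. of_real (2 * (z \<bullet> v) / (z \<bullet> z)))"
    using frechet_derivative_at[OF has_derivative_log_norm_sq[OF assms]] by simp
  have "dc log_norm_sq z v = \<i> / (4 * of_real pi) * (\<i> * of_real (2 * (z \<bullet> (\<i> *s v 0)) / (z \<bullet> z)))"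
    by (simp add: dc_def del_def delbar_def D add_divide_distrib diff_divide_distrib)
  also have "\<dots> = of_real (- (z \<bullet> (\<i> *s v 0)) / (2 * pi * (z \<bullet> z)))"
    by (simp add: field_simps)
  finally show ?thesis by (simp only: inner_ii_skew)
qed

text \<open>In directions tangent to the sphere the factor 1/|z|^2 has derivative zero, so only the
  linear numerator is differentiated.\<close>

lemma ext_deriv_dc_log_norm_sq:
  fixes z :: "complex ^ 'n::finite"
  assumes z: "z \<noteq> 0" and v: "z \<bullet> v 0 = 0" "z \<bullet> v 1 = 0"
  shows "ext_deriv 1 (dc log_norm_sq) z v = of_real (((\<i> *s v 0) \<bullet> v 1) / (pi * (z \<bullet> z)))"
proof -
  have D: "frechet_derivative (\<lambda>w. dc log_norm_sq w u) (at z) d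
      = of_real (((\<i> *s d) \<bullet> u 0) / (2 * pi * (z \<bullet> z)))" if "z \<bullet> d = 0" for u d
  proof -
    let ?g = "\<lambda>w. of_real (((\<i> *s w) \<bullet> u 0) / (2 * pi * (w \<bullet> w))) :: complex"
    let ?D = "\<lambda>d. of_real ((((\<i> *s d) \<bullet> u 0) * (2 * pi * (z \<bullet> z))
        - ((\<i> *s z) \<bullet> u 0) * (2 * pi * (2 * (z \<bullet> d)))) / (2 * pi * (z \<bullet> z))\<^sup>2) :: complex"
    have dc_eq: "?g w = dc log_norm_sq w u" if "w \<in> - {0}" for w
      by (rule dc_log_norm_sq[symmetric]) (use that in simp)
    have num: "((\<lambda>w. (\<i> *s w) \<bullet> u 0) has_derivative (\<lambda>d. (\<i> *s d) \<bullet> u 0)) (at z)"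
      by (intro has_derivative_inner_left bounded_linear_imp_has_derivative linear_ii)
    have "((\<lambda>w. w \<bullet> w) has_derivative (\<lambda>d. z \<bullet> d + d \<bullet> z)) (at z)"
      by (intro has_derivative_inner has_derivative_ident)
    from has_derivative_mult_right[OF this, of "2 * pi"]
    have den: "((\<lambda>w. 2 * pi * (w \<bullet> w)) has_derivative (\<lambda>d. 2 * pi * (2 * (z \<bullet> d)))) (at z)"
      by (simp add: inner_commute algebra_simps)
    have "2 * pi * (z \<bullet> z) \<noteq> 0" using z by simp
    from has_derivative_of_real[OF has_derivative_divide'[OF num den this]]
    have gD: "(?g has_derivative ?D) (at z)"
      unfolding power2_eq_square .
    have "((\<lambda>w. dc log_norm_sq w u) has_derivative ?D) (at z)"
    proof (rule has_derivative_transform_within_open[OF gD])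
      show "open (- {0 :: complex ^ 'n})" by (intro open_Compl closed_singleton)
    qed (use z dc_eq in auto)
    from fun_cong[OF frechet_derivative_at[OF this], of d]
    have "frechet_derivative (\<lambda>w. dc log_norm_sq w u) (at z) d = ?D d"
      by (rule sym)
    also have "\<dots> = of_real (((\<i> *s d) \<bullet> u 0) / (2 * pi * (z \<bullet> z)))"
      using z that by (simp add: power2_eq_square)
    finally show ?thesis .
  qed
  have "ext_deriv 1 (dc log_norm_sq) z v
      = of_real (((\<i> *s v 0) \<bullet> v 1) / (2 * pi * (z \<bullet> z)))
        - of_real (((\<i> *s v 1) \<bullet> v 0) / (2 * pi * (z \<bullet> z)))"
    using v by (simp add: ext_deriv_def D)
  \<comment> \<open>By skewness the two terms of the exterior derivative add up, which turns 1/(2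
    pi) into 1/pi.\<close>
  also have "(\<i> *s v 1) \<bullet> v 0 = - ((\<i> *s v 0) \<bullet> v 1)"
    by (metis inner_ii_skew inner_commute)
  finally show ?thesis using z by (simp add: field_simps flip: of_real_diff of_real_add)
qed

section \<open>Adapted frames and the value of sigma on them\<close>

text \<open>Gram-Schmidt for the real inner product, two vectors at a time: the span of the frame
  built so far is stable under i, so a unit vector orthogonal to it brings i times itself along.
  Existence is what gives the \<open>SOME\<close> in \<open>tangent_frame\<close> its
  meaning.\<close>

lemma adapted_basis_exists:
  fixes z :: "complex ^ 'n::finite"
  assumes "z \<noteq> 0"
  shows "\<exists>b. adapted_basis z b"
proof -
  have "\<exists>b. b 0 = z /\<^sub>R norm z \<and> (\<forall>k < 2 * m. \<forall>l < 2 * m.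
        real_frame b k \<bullet> real_frame b l = (if k = l then 1 else 0))" if "m \<le> CARD('n)" for m
    using that
  proof (induction m)
    case 0
    show ?case by (intro exI[of _ "\<lambda>_. z /\<^sub>R norm z"]) simp
  next
    case (Suc m)
    then obtain b where b: "b 0 = z /\<^sub>R norm z"
      "\<And>k l. k < 2 * m \<Longrightarrow> l < 2 * m \<Longrightarrow>
        real_frame b k \<bullet> real_frame b l = (if k = l then 1 else 0)"
      by auto
    obtain x where x: "norm x = 1" "\<And>k. k < 2 * m \<Longrightarrow> x \<bullet> real_frame b k = 0"
      "m = 0 \<Longrightarrow> x = z /\<^sub>R norm z"
    proof (cases "m = 0")
      case True
      then show ?thesis using assms by (intro that[of "z /\<^sub>R norm z"]) auto
    next
      case False
      let ?A = "real_frame b ` {..<2 * m}"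
      have "dim ?A \<le> card {..<2 * m}"
        by (rule order_trans[OF dim_le_card' card_image_le]) auto
      also have "\<dots> < DIM(complex ^ 'n)" using Suc.prems by simp
      finally obtain y where y: "y \<noteq> 0" "\<And>u. u \<in> span ?A \<Longrightarrow> orthogonal y u"
        using orthogonal_to_subspace_exists by metis
      have "y \<bullet> real_frame b k = 0" if "k < 2 * m" for k
        using y(2)[of "real_frame b k"] that by (auto simp: orthogonal_def intro: span_base)
      then show ?thesis using y(1) False
        by (intro that[of "y /\<^sub>R norm y"]) auto
    qed
    let ?b = "b(m := x)"
    have old: "real_frame ?b k = real_frame b k" if "k < 2 * m" for k
      using that by (auto simp: real_frame_def)
    have new: "real_frame ?b (2 * m) = x" "real_frame ?b (Suc (2 * m)) = \<i> *s x"
      by (auto simp: real_frame_def)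
    \<comment> \<open>Multiplication by i permutes the old frame vectors up to sign, so
      orthogonality passes from \<open>x\<close> to its multiple by i.\<close>
    have ix: "(\<i> *s x) \<bullet> real_frame b k = 0" if "k < 2 * m" for k
    proof (cases "even k")
      case True
      then have "Suc k < 2 * m" "\<i> *s real_frame b k = real_frame b (Suc k)"
        using that by (auto simp: real_frame_def elim!: evenE)
      then show ?thesis by (simp add: inner_ii_skew x)
    next
      case False
      then have "\<i> *s real_frame b k = - real_frame b (k - 1)"
        by (auto simp: real_frame_def ii_smult elim!: oddE)
      then show ?thesis using that by (simp add: inner_ii_skew x)
    qed
    have xx: "x \<bullet> x = 1" "x \<bullet> (\<i> *s x) = 0" "(\<i> *s x) \<bullet> x = 0" "(\<i> *s x) \<bullet> (\<i> *s x) = 1"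
      using x(1) inner_ii_skew[of x x] inner_commute[of "\<i> *s x" x]
      by (auto simp: inner_ii_ii norm_eq_1)
    have "real_frame ?b k \<bullet> real_frame ?b l = (if k = l then 1 else 0)"
      if "k < 2 * Suc m" "l < 2 * Suc m" for k l
    proof -
      have "k < 2 * m \<or> k = 2 * m \<or> k = Suc (2 * m)" "l < 2 * m \<or> l = 2 * m \<or> l = Suc (2 * m)"
        using that by auto
      then show ?thesis
        by (elim disjE) (simp_all add: old new b x ix xx inner_commute[of "real_frame b _" x]
            inner_commute[of "real_frame b _" "\<i> *s x"])
    qed
    moreover have "?b 0 = z /\<^sub>R norm z" using b x by auto
    ultimately show ?case by blast
  qed
  from this[of "CARD('n)"] show ?thesis unfolding adapted_basis_def by simp
qed

lemma inner_ii_real_frame: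
  assumes b: "\<forall>k < 2 * m. \<forall>l < 2 * m. real_frame b k \<bullet> real_frame b l = (if k = l then 1 else 0)"
    and "s 0 < 2 * m" "s 1 < 2 * m"
  shows "of_real ((\<i> *s real_frame b (s 0)) \<bullet> real_frame b (s 1)) = pairing z s"
proof (cases "even (s 0)")
  case True
  then have "Suc (s 0) < 2 * m" "\<i> *s real_frame b (s 0) = real_frame b (Suc (s 0))"
    using assms(2) by (auto simp: real_frame_def elim!: evenE)
  then show ?thesis using b assms(3) True
    by (auto simp: pairing_def)
next
  case False
  then have "\<i> *s real_frame b (s 0) = - real_frame b (s 0 - 1)"
    by (auto simp: real_frame_def ii_smult elim!: oddE)
  moreover have "s 0 - 1 = s 1 \<longleftrightarrow> even (s 1) \<and> s 0 = Suc (s 1)"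
    using False by presburger
  ultimately show ?thesis using b assms(2,3) False
    by (auto simp: pairing_def)
qed

text \<open>Only the orthonormality relations and the position of z in the frame enter, so every z
  reduces to the same index form and one constant serves for all. The factors 1/r and (1/r^2)^(n -
  1) give the exponent 2n - 1.\<close>

lemma sigma_form_tangent_frame:
  obtains c :: real where "c > 0"
    "\<And>z :: complex ^ 'n::finite. z \<noteq> 0 \<Longrightarrow>
      sigma_form z (tangent_frame z) = of_real (c / norm z ^ (2 * CARD('n) - 1))"
proof -
  define m where "m = CARD('n) - 1"
  have m: "CARD('n) = Suc m"
    unfolding m_def using zero_less_card_finite[where 'a='n] by simp
  define \<alpha> :: "nat cform" where "\<alpha> = (\<lambda>z s. if s 0 = 1 then 1 else 0)"
  \<comment> \<open>The base point 0 is a dummy: \<open>\<alpha>\<close> and \<open>pairing\<close>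
    depend on the indices alone.\<close>
  obtain c :: real where c: "c > 0"
    "wedge 1 (2 * m) \<alpha> (wedge_power 2 pairing m) 0 Suc = of_real c"
    using wedge_dual_pairing_pos[of \<alpha>] unfolding \<alpha>_def by metis
  have "sigma_form z (tangent_frame z)
      = of_real ((c / (2 * pi * pi ^ m)) / norm z ^ (2 * CARD('n) - 1))"
    if z: "z \<noteq> 0" for z :: "complex ^ 'n"
  proof -
    define b where "b = (SOME b. adapted_basis z b)"
    have "adapted_basis z b"
      unfolding b_def using someI_ex[OF adapted_basis_exists[OF z]] .
    then have b0: "b 0 = z /\<^sub>R norm z"
      and b: "\<forall>k < 2 * Suc m. \<forall>l < 2 * Suc m.
        real_frame b k \<bullet> real_frame b l = (if k = l then 1 else 0)"
      by (auto simp: adapted_basis_def m)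
    have z_eq: "z = norm z *\<^sub>R real_frame b 0" "\<i> *s z = norm z *\<^sub>R real_frame b 1"
      using z by (auto simp: real_frame_def b0 vec_eq_iff)
    have zz: "z \<bullet> z = (norm z)\<^sup>2" by (simp add: power2_norm_eq_inner)
    have "sigma_form z (\<lambda>j. real_frame b (Suc j))
      = of_real (1 / (2 * pi * norm z)) * of_real (1 / (pi * (norm z)\<^sup>2)) ^ m *
        wedge 1 (2 * m) \<alpha> (wedge_power 2 pairing m) 0 Suc"
      unfolding sigma_form_def m_def[symmetric]
    \<comment> \<open>Excluding the radial index 0 keeps all vectors tangent to the sphere, as the
      formula for dd^c requires.\<close>
    proof (rule wedge_pullback[where S="{1..<2 * Suc m}"])
      fix s :: "nat \<Rightarrow> nat" assume s: "\<forall>j<1. s j \<in> {1..<2 * Suc m}"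
      have "(\<i> *s z) \<bullet> real_frame b (s 0) = norm z * (if s 0 = 1 then 1 else 0)"
        using b s by (subst z_eq) auto
      then show "dc log_norm_sq z (\<lambda>j. real_frame b (s j)) = of_real (1 / (2 * pi * norm z)) * \<alpha> 0 s"
        using z by (simp add: dc_log_norm_sq \<alpha>_def zz power2_eq_square)
    next
      fix s :: "nat \<Rightarrow> nat" assume s: "\<forall>j<2 * m. s j \<in> {1..<2 * Suc m}"
      show "wedge_power 2 (ext_deriv 1 (dc log_norm_sq)) m z (\<lambda>j. real_frame b (s j)) =
          of_real (1 / (pi * (norm z)\<^sup>2)) ^ m * wedge_power 2 pairing m 0 s"
      proof (rule wedge_power_pullback[OF _ s])
        fix s :: "nat \<Rightarrow> nat" assume s: "\<forall>j<2. s j \<in> {1..<2 * Suc m}"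
        have s01: "s 0 \<in> {1..<2 * Suc m}" "s 1 \<in> {1..<2 * Suc m}" using s by auto
        have orth: "z \<bullet> real_frame b (s 0) = 0" "z \<bullet> real_frame b (s 1) = 0"
          using b s01 by (subst z_eq, simp)+
        have "ext_deriv 1 (dc log_norm_sq) z (\<lambda>j. real_frame b (s j))
          = of_real (((\<i> *s real_frame b (s 0)) \<bullet> real_frame b (s 1)) / (pi * (z \<bullet> z)))"
          by (rule ext_deriv_dc_log_norm_sq) (use z orth in auto)
        also have "\<dots> = of_real (1 / (pi * (norm z)\<^sup>2)) * of_real ((\<i> *s real_frame b (s 0)) \<bullet> real_frame b (s 1))"
          by (simp add: zz)
        finally show "ext_deriv 1 (dc log_norm_sq) z (\<lambda>j. real_frame b (s j))
          = of_real (1 / (pi * (norm z)\<^sup>2)) * pairing 0 s"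
          using inner_ii_real_frame[OF b, of s 0] s01 by simp
      qed
    qed auto
    also have "\<dots> = of_real (1 / (2 * pi * norm z) * (1 / (pi * (norm z)\<^sup>2)) ^ m * c)"
      unfolding c(2) by simp
    also have "1 / (2 * pi * norm z) * (1 / (pi * (norm z)\<^sup>2)) ^ m * c
        = (c / (2 * pi * pi ^ m)) / norm z ^ (2 * CARD('n) - 1)"
      by (simp add: m power_divide power_mult_distrib field_simps flip: power_mult)
    finally show ?thesis
      unfolding tangent_frame_def b_def .
  qed
  then show thesis using c(1)
    by (intro that[of "c / (2 * pi * pi ^ m)"]) auto
qed

section \<open>The characteristic as an integral over the unit ball\<close>

text \<open>The radial projection does not see the substitution x = r y, so only the volume factor
  r^d appears; with d / r from the cone definition it becomes d r^(d - 1).\<close>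

lemma integral_sphere_measure:
  fixes g :: "'a::euclidean_space \<Rightarrow> 'b::{banach, second_countable_topology}"
  assumes r: "r > 0" and g [measurable]: "g \<in> borel_measurable borel"
  shows "integral\<^sup>L (sphere_measure r) g
    = (real DIM('a) * r ^ (DIM('a) - 1)) *\<^sub>R
      (LINT y|lborel. indicator (cball 0 1) y *\<^sub>R g ((r / norm y) *\<^sub>R y))"
proof -
  define a where "a = real DIM('a) / r"
  define T :: "'a \<Rightarrow> 'a" where "T = (\<lambda>x. (r / norm x) *\<^sub>R x)"
  have [measurable]: "T \<in> borel_measurable borel"
    unfolding T_def by measurable
  define M :: "'a measure" where "M = restrict_space lborel (cball 0 r)"
  have T: "T \<in> measurable M borel"
    unfolding M_def by (rule measurable_restrict_space1) simp
  have gT: "(\<lambda>x. g (T x)) \<in> borel_measurable borel"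
    by (rule measurable_compose[OF _ g]) measurable
  have h: "(\<lambda>x. indicator (cball 0 r) x *\<^sub>R g (T x)) \<in> borel_measurable borel"
    by (intro borel_measurable_scaleR borel_measurable_indicator gT) simp
  have a: "a \<ge> 0" using r by (simp add: a_def)
  have "sphere_measure r = density (distr M borel T) (\<lambda>_. ennreal a)"
    unfolding sphere_measure_def T_def[symmetric] M_def[symmetric] a_def[symmetric]
    by (rule measure_eqI) (auto simp: emeasure_density_const)
  then have "integral\<^sup>L (sphere_measure r) g = a *\<^sub>R integral\<^sup>L (distr M borel T) g"
    using a by (simp add: integral_density)
  also have "integral\<^sup>L (distr M borel T) g = (LINT x|M. g (T x))"
    by (rule integral_distr[OF T g])
  also have "\<dots> = (LINT x|lborel. indicator (cball 0 r) x *\<^sub>R g (T x))"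
    unfolding M_def by (rule integral_restrict_space) simp
  also have "\<dots> = r ^ DIM('a) *\<^sub>R
      (LINT y|lborel. indicator (cball 0 r) (r *\<^sub>R y) *\<^sub>R g (T (r *\<^sub>R y)))"
  proof -
    let ?f = "\<lambda>x. indicator (cball 0 r) x *\<^sub>R g (T x)"
    have dist: "(\<lambda>x. r *\<^sub>R x) \<in> measurable lborel borel" by simp
    have "integral\<^sup>L lborel ?f
        = integral\<^sup>L (density (distr lborel borel (\<lambda>x. r *\<^sub>R x)) (\<lambda>_. ennreal (r ^ DIM('a)))) ?f"
      by (subst lborel_affine[of r 0]) (use r in simp_all)
    also have "\<dots> = (LINT x|distr lborel borel (\<lambda>x. r *\<^sub>R x). r ^ DIM('a) *\<^sub>R ?f x)"
      by (rule integral_density) (use h r in auto)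
    also have "\<dots> = r ^ DIM('a) *\<^sub>R (LINT x|distr lborel borel (\<lambda>x. r *\<^sub>R x). ?f x)"
      by (rule integral_scaleR_right)
    finally show ?thesis
      unfolding integral_distr[OF dist h] .
  qed
  also have "(\<lambda>y. indicator (cball 0 r) (r *\<^sub>R y) *\<^sub>R g (T (r *\<^sub>R y)))
      = (\<lambda>y. indicator (cball 0 1) y *\<^sub>R g ((r / norm y) *\<^sub>R y))"
  proof
    fix y :: 'a
    have "T (r *\<^sub>R y) = (r / norm y) *\<^sub>R y"
      using r by (simp add: T_def)
    moreover have "r *\<^sub>R y \<in> cball 0 r \<longleftrightarrow> y \<in> cball 0 1"
      using r by simp
    ultimately show "indicator (cball 0 r) (r *\<^sub>R y) *\<^sub>R g (T (r *\<^sub>R y))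
        = indicator (cball 0 1) y *\<^sub>R g ((r / norm y) *\<^sub>R y)"
      by (simp add: indicator_def)
  qed
  also have "a *\<^sub>R r ^ DIM('a) *\<^sub>R (LINT y|lborel. indicator (cball 0 1) y *\<^sub>R g ((r / norm y) *\<^sub>R y))
      = (real DIM('a) * r ^ (DIM('a) - 1)) *\<^sub>R
        (LINT y|lborel. indicator (cball 0 1) y *\<^sub>R g ((r / norm y) *\<^sub>R y))"
    using r by (simp add: a_def power_eq_if)
  finally show ?thesis .
qed

text \<open>The area factor r^(2n - 1) cancels the decay of sigma, which is why \<open>K\<close> can
  be chosen before \<open>r\<close>.\<close>

lemma nev_char_eq:
  obtains K :: real where "K > 0"
    "\<And>r (f :: complex ^ 'n::finite \<Rightarrow> complex).
      r > 0 \<Longrightarrow> (\<lambda>z. log_plus (norm (f z))) \<in> borel_measurable borel \<Longrightarrow>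
      nev_char r f = K * (LINT y|lborel. indicator (cball 0 1) y *
        log_plus (norm (f ((r / norm y) *\<^sub>R y))))"
proof -
  let ?D = "DIM(complex ^ 'n)"
  have D: "2 * CARD('n) = ?D" by simp
  obtain c :: real where c: "c > 0"
    "\<And>z :: complex ^ 'n. z \<noteq> 0 \<Longrightarrow>
      sigma_form z (tangent_frame z) = of_real (c / norm z ^ (?D - 1))"
    by (rule sigma_form_tangent_frame[where 'n='n, unfolded D]) (erule that, blast)
  have "nev_char r f = (real ?D * c) *
      (LINT y|lborel. indicator (cball 0 1) y * log_plus (norm (f ((r / norm y) *\<^sub>R y))))"
    if r: "r > 0" and L [measurable]: "(\<lambda>z. log_plus (norm (f z))) \<in> borel_measurable borel"
    for r and f :: "complex ^ 'n \<Rightarrow> complex"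
  proof -
    define L where "L = (\<lambda>z. log_plus (norm (f z)))"
    have [measurable]: "L \<in> borel_measurable borel" unfolding L_def by (rule L)
    define \<phi> where "\<phi> = (\<lambda>z. of_real (L z) * sigma_form z (tangent_frame z))"
    define T :: "complex ^ 'n \<Rightarrow> complex ^ 'n" where "T = (\<lambda>y. (r / norm y) *\<^sub>R y)"
    have [measurable]: "T \<in> borel_measurable borel" unfolding T_def by measurable
    have ball [measurable]: "(\<lambda>y. indicator (cball 0 1) y :: real) \<in> borel_measurable (borel :: (complex ^ 'n) measure)"
      by (intro borel_measurable_indicator) simp
    \<comment> \<open>The chosen frames need not vary measurably with z, but away from the origin
      the value of sigma on them is an explicit function of the norm.\<close>
    have "\<phi> = (\<lambda>z. if z = 0 then \<phi> 0 else of_real (L z * (c / norm z ^ (?D - 1))))"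
      unfolding \<phi>_def by (auto simp: c(2))
    also have "\<dots> \<in> borel_measurable borel" by measurable
    finally have [measurable]: "\<phi> \<in> borel_measurable borel" .
    have "sphere_integral r (\<lambda>z v. of_real (log_plus (norm (f z))) * sigma_form z v)
        = integral\<^sup>L (sphere_measure r) \<phi>"
      unfolding sphere_integral_def \<phi>_def L_def ..
    also have "\<dots> = (real ?D * r ^ (?D - 1)) *\<^sub>R
        (LINT y|lborel. indicator (cball 0 1) y *\<^sub>R \<phi> (T y))"
      unfolding T_def by (rule integral_sphere_measure[OF r]) measurable
    also have "(LINT y|lborel. indicator (cball 0 1) y *\<^sub>R \<phi> (T y))
        = (LINT y|lborel. of_real (c / r ^ (?D - 1) * (indicator (cball 0 1) y * L (T y))))"
    proof (rule integral_cong_AE)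
      have eq: "indicator (cball 0 1) y *\<^sub>R \<phi> (T y)
          = of_real (c / r ^ (?D - 1) * (indicator (cball 0 1) y * L (T y)))" if "y \<noteq> 0" for y
      proof -
        have "norm (T y) = r" "T y \<noteq> 0" using r that by (auto simp: T_def)
        then show ?thesis by (simp add: \<phi>_def c(2) scaleR_conv_of_real)
      qed
      \<comment> \<open>At y = 0 the projection returns 0, which is off the sphere; this single
        point is a null set.\<close>
      show "AE y in lborel. indicator (cball 0 1) y *\<^sub>R \<phi> (T y)
          = of_real (c / r ^ (?D - 1) * (indicator (cball 0 1) y * L (T y)))"
        using AE_lborel_singleton[of "0 :: complex ^ 'n"] by (rule eventually_mono) (rule eq)
    qed measurable
    also have "\<dots> = of_real (c / r ^ (?D - 1) * (LINT y|lborel. indicator (cball 0 1) y * L (T y)))"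
      unfolding integral_complex_of_real integral_mult_right_zero ..
    finally show ?thesis
      using r by (simp add: nev_char_def L_def T_def)
  qed
  then show thesis using c(1) by (intro that[of "real ?D * c"]) auto
qed

section \<open>Leading forms\<close>

text \<open>Uniqueness of base N expansions: reduction modulo N isolates the lowest digit, and
  cancelling it leaves a shorter expansion.\<close>

lemma sum_digits_inj:
  fixes a b :: "nat \<Rightarrow> nat"
  assumes "(\<Sum>i<k. N ^ i * a i) = (\<Sum>i<k. N ^ i * b i)"
    and "\<And>i. i < k \<Longrightarrow> a i < N" "\<And>i. i < k \<Longrightarrow> b i < N" and "i < k"
  shows "a i = b i"
  using assms
proof (induction k arbitrary: a b i)
  case (Suc k)
  have split: "(\<Sum>i<Suc k. N ^ i * f i) = f 0 + N * (\<Sum>i<k. N ^ i * f (Suc i))" for f :: "nat \<Rightarrow> nat"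
    by (simp add: sum.lessThan_Suc_shift sum_distrib_left mult.assoc del: sum.lessThan_Suc)
  have eq: "a 0 + N * (\<Sum>i<k. N ^ i * a (Suc i)) = b 0 + N * (\<Sum>i<k. N ^ i * b (Suc i))"
    using Suc.prems(1) by (simp only: split)
  have lt: "a 0 < N" "b 0 < N" using Suc.prems by auto
  have "a 0 = (a 0 + N * (\<Sum>i<k. N ^ i * a (Suc i))) mod N" using lt by simp
  also have "\<dots> = b 0" unfolding eq using lt by simp
  finally have 0: "a 0 = b 0" .
  then have "(\<Sum>i<k. N ^ i * a (Suc i)) = (\<Sum>i<k. N ^ i * b (Suc i))"
    using eq lt by auto
  then have "a (Suc j) = b (Suc j)" if "j < k" for j
    using Suc.IH[of "\<lambda>i. a (Suc i)" "\<lambda>i. b (Suc i)" j] Suc.prems that by auto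
  then show ?case using 0 Suc.prems(4) by (cases i) auto
qed simp

text \<open>
  Kronecker substitution: the powers \<open>z\<^sub>j = t ^ (N ^ j)\<close>, with \<open>N\<close> larger than all exponents,
  turn distinct monomials into distinct powers of \<open>t\<close>.
\<close>

lemma monomial_sum_nonzero:
  fixes c :: "('n::finite \<Rightarrow>\<^sub>0 nat) \<Rightarrow> complex"
  assumes S: "finite S" and m0: "m0 \<in> S" "c m0 \<noteq> 0"
  obtains z :: "complex ^ 'n"
    where "(\<Sum>m\<in>S. c m * (\<Prod>j\<in>UNIV. (z $ j) ^ Poly_Mapping.lookup m j)) \<noteq> 0"
proof -
  obtain N where N: "\<And>m j. m \<in> S \<Longrightarrow> Poly_Mapping.lookup m j < N"
  proof -
    let ?A = "(\<lambda>(m, j). Poly_Mapping.lookup m j) ` (S \<times> (UNIV :: 'n set))"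
    have "Poly_Mapping.lookup m j < Suc (Max ?A)" if "m \<in> S" for m j
      unfolding less_Suc_eq_le by (rule Max_ge) (use S that in auto)
    then show thesis by (rule that)
  qed
  obtain e :: "nat \<Rightarrow> 'n" where e: "bij_betw e {..<CARD('n)} UNIV"
    using ex_bij_betw_nat_finite[of "UNIV :: 'n set"] by (auto simp: atLeast0LessThan)
  define e' where "e' = inv_into {..<CARD('n)} e"
  \<comment> \<open>The base N number whose digits are the exponents of the monomial, with
    \<open>e'\<close> numbering the variables.\<close>
  define w where "w m = (\<Sum>j\<in>UNIV. N ^ e' j * Poly_Mapping.lookup m j)" for m :: "'n \<Rightarrow>\<^sub>0 nat"
  have w: "w m = (\<Sum>i<CARD('n). N ^ i * Poly_Mapping.lookup m (e i))" for m
    unfolding w_def e'_def using e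
    by (subst sum.reindex_bij_betw[OF e, symmetric])
       (auto intro!: sum.cong simp: bij_betw_inv_into_left)
  have inj: "m = m0" if "m \<in> S" "w m = w m0" for m
  proof (rule poly_mapping_eqI)
    fix j
    obtain i where i: "i < CARD('n)" "j = e i"
      using e unfolding bij_betw_def by (metis UNIV_I image_iff lessThan_iff)
    show "Poly_Mapping.lookup m j = Poly_Mapping.lookup m0 j"
      unfolding i(2)
      by (rule sum_digits_inj[where k="CARD('n)" and N=N and a="\<lambda>i. Poly_Mapping.lookup m (e i)"
            and b="\<lambda>i. Poly_Mapping.lookup m0 (e i)"])
         (use that m0 N i in \<open>auto simp: w\<close>)
  qed
  define p where "p = (\<Sum>m\<in>S. Polynomial.monom (c m) (w m))"
  \<comment> \<open>By injectivity of the encoding no other monomial can cancel the coefficient of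
    \<open>m0\<close>.\<close>
  have "Polynomial.coeff p (w m0) = (\<Sum>m\<in>S. if m = m0 then c m0 else 0)"
    unfolding p_def coeff_sum by (rule sum.cong) (auto dest: inj)
  also have "\<dots> = c m0" using S m0 by simp
  finally have "p \<noteq> 0" using m0 by auto
  then obtain t where t: "poly p t \<noteq> 0" using poly_all_0_iff_0 by blast
  let ?z = "(\<chi> j. t ^ (N ^ e' j)) :: complex ^ 'n"
  have "(\<Sum>m\<in>S. c m * (\<Prod>j\<in>UNIV. (?z $ j) ^ Poly_Mapping.lookup m j)) = poly p t"
    unfolding p_def poly_sum poly_monom w_def
    by (simp add: power_sum flip: power_mult)
  with t show thesis by (intro that[of ?z]) simp
qed

section \<open>The homogeneous part of top degree\<close>

definition monomial_fun :: "('n::finite \<Rightarrow>\<^sub>0 nat) \<Rightarrow> complex ^ 'n \<Rightarrow> complex" where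
  "monomial_fun m z = (\<Prod>j\<in>UNIV. (z $ j) ^ Poly_Mapping.lookup m j)"

definition monomial_degree :: "('n::finite \<Rightarrow>\<^sub>0 nat) \<Rightarrow> nat" where
  "monomial_degree m = (\<Sum>j\<in>UNIV. Poly_Mapping.lookup m j)"

definition leading_form :: "('n::finite) cpoly \<Rightarrow> complex ^ 'n \<Rightarrow> complex" where
  "leading_form p z = (\<Sum>m | m \<in> Poly_Mapping.keys p \<and> monomial_degree m = total_degree p.
     Poly_Mapping.lookup p m * monomial_fun m z)"

lemma monomial_fun_smult: "monomial_fun m (c *s z) = c ^ monomial_degree m * monomial_fun m z"
  by (simp add: monomial_fun_def monomial_degree_def power_mult_distrib prod.distrib power_sum)

lemma norm_monomial_fun_le:
  assumes "norm z \<le> 1"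
  shows "norm (monomial_fun m z) \<le> 1"
  unfolding monomial_fun_def prod_norm[symmetric] norm_power
  by (intro prod_le_1 conjI zero_le_power norm_ge_zero power_le_one
      order_trans[OF Finite_Cartesian_Product.norm_nth_le assms])

lemma continuous_on_monomial_fun [continuous_intros]:
  assumes "continuous_on A g"
  shows "continuous_on A (\<lambda>x. monomial_fun m (g x))"
  unfolding monomial_fun_def by (intro continuous_intros assms)

lemma continuous_on_leading_form [continuous_intros]:
  assumes "continuous_on A g"
  shows "continuous_on A (\<lambda>x. leading_form p (g x))"
  unfolding leading_form_def by (intro continuous_intros assms)

lemma poly_fun_eq:
  "poly_fun p z = (\<Sum>m\<in>Poly_Mapping.keys p. Poly_Mapping.lookup p m * monomial_fun m z)"
  by (simp add: poly_fun_def monomial_fun_def)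

lemma continuous_on_poly_fun: "continuous_on A (poly_fun p)"
  unfolding poly_fun_eq[abs_def] by (intro continuous_intros)

lemma monomial_degree_le:
  assumes "m \<in> Poly_Mapping.keys p"
  shows "monomial_degree m \<le> total_degree p"
  using assms unfolding total_degree_def monomial_degree_def by (intro Max_ge) auto

text \<open>Non-constancy of the polynomial enters here: in degree 0 the zero exponent vector is the
  only possible key.\<close>

lemma total_degree_pos:
  fixes p :: "('n::finite) cpoly"
  assumes "\<not> constant_poly p"
  shows "total_degree p > 0"
proof (rule ccontr)
  assume 0: "\<not> total_degree p > 0"
  have "m = 0" if "m \<in> Poly_Mapping.keys p" for m
  proof (rule poly_mapping_eqI)
    show "Poly_Mapping.lookup m j = Poly_Mapping.lookup 0 j" for j
      using monomial_degree_le[OF that] 0 by (simp add: monomial_degree_def)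
  qed
  then have "p = Poly_Mapping.single 0 (Poly_Mapping.lookup p 0)"
    by (intro poly_mapping_eqI) (auto simp: lookup_single when_def in_keys_iff)
  then show False using assms unfolding constant_poly_def by blast
qed

lemma total_degree_attained:
  fixes p :: "('n::finite) cpoly"
  assumes "total_degree p > 0"
  obtains m where "m \<in> Poly_Mapping.keys p" "monomial_degree m = total_degree p"
proof -
  have "total_degree p \<in> insert 0 (monomial_degree ` Poly_Mapping.keys p)"
    unfolding total_degree_def monomial_degree_def by (rule Max_in) auto
  then show thesis using assms that by auto
qed

lemma leading_form_smult: "leading_form p (c *s z) = c ^ total_degree p * leading_form p z"
  unfolding leading_form_def sum_distrib_left
  by (rule sum.cong) (auto simp: monomial_fun_smult)

lemma leading_form_pos_exists:
  fixes p :: "('n::finite) cpoly"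
  assumes d: "total_degree p > 0"
  obtains z where "z \<noteq> 0" "Re (leading_form p z) > 0"
proof -
  obtain m where m: "m \<in> Poly_Mapping.keys p" "monomial_degree m = total_degree p"
    by (rule total_degree_attained[OF d])
  obtain y :: "complex ^ 'n" where y: "leading_form p y \<noteq> 0"
    using monomial_sum_nonzero[of "{m \<in> Poly_Mapping.keys p. monomial_degree m = total_degree p}"
        m "Poly_Mapping.lookup p"] m
    unfolding leading_form_def monomial_fun_def by (auto simp: in_keys_iff)
  \<comment> \<open>Rotating y by an angle rotates the value by \<open>total_degree p\<close> times
    that angle, so this choice turns the value onto the positive real axis.\<close>
  define \<theta> where "\<theta> = - Arg (leading_form p y) / total_degree p"
  have "real (total_degree p) * \<theta> = - Arg (leading_form p y)"
    using d by (simp add: \<theta>_def)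
  then have power: "cis \<theta> ^ total_degree p = cis (- Arg (leading_form p y))"
    by (simp only: Complex.DeMoivre)
  have "leading_form p (cis \<theta> *s y) = cis (- Arg (leading_form p y)) * leading_form p y"
    unfolding leading_form_smult power by simp
  also have "\<dots> = cis (- Arg (leading_form p y)) *
      (of_real (norm (leading_form p y)) * cis (Arg (leading_form p y)))"
    by (metis rcis_cmod_Arg rcis_def)
  also have "\<dots> = of_real (norm (leading_form p y))"
    by (simp add: cis_mult mult.left_commute)
  finally have *: "Re (leading_form p (cis \<theta> *s y)) > 0" using y by simp
  \<comment> \<open>Positive degree makes the form vanish at the origin, so a point with nonzero
    value is itself nonzero.\<close>
  have "leading_form p 0 = 0"
    using leading_form_smult[of p 0 0] d by (simp add: zero_power)
  then have "cis \<theta> *s y \<noteq> 0" using * by auto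
  then show thesis using * by (rule that)
qed

section \<open>Growth of a polynomial along rays\<close>

lemma norm_poly_fun_le:
  fixes p :: "('n::finite) cpoly"
  assumes "norm z = 1" "r \<ge> 1"
  shows "norm (poly_fun p (r *\<^sub>R z))
    \<le> (\<Sum>m\<in>Poly_Mapping.keys p. norm (Poly_Mapping.lookup p m)) * r ^ total_degree p"
proof -
  let ?c = "Poly_Mapping.lookup p" and ?K = "Poly_Mapping.keys p" and ?d = "total_degree p"
  have scale: "r *\<^sub>R z = of_real r *s z"
    by (simp add: vec_eq_iff complex_eq_iff)
  have "norm (poly_fun p (r *\<^sub>R z)) \<le> (\<Sum>m\<in>?K. norm (?c m) * r ^ ?d)"
    unfolding poly_fun_eq
  proof (rule sum_norm_le)
    fix m assume m: "m \<in> ?K"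
    have "r ^ monomial_degree m * norm (monomial_fun m z) \<le> r ^ ?d * 1"
      using assms monomial_degree_le[OF m]
      by (intro mult_mono power_increasing norm_monomial_fun_le) auto
    then show "norm (?c m * monomial_fun m (r *\<^sub>R z)) \<le> norm (?c m) * r ^ ?d"
      using assms by (simp add: scale monomial_fun_smult norm_mult norm_power mult_left_mono)
  qed
  then show ?thesis by (simp add: sum_distrib_right)
qed

text \<open>The monomials outside the leading form have degree at most d - 1. The gain of one power
  of r, uniform over the unit sphere, lets the leading form dominate.\<close>

lemma norm_poly_fun_minus_leading_form_le:
  fixes p :: "('n::finite) cpoly"
  assumes "norm z = 1" "r \<ge> 1"
  shows "norm (poly_fun p (r *\<^sub>R z) - r ^ total_degree p *\<^sub>R leading_form p z)
    \<le> (\<Sum>m\<in>Poly_Mapping.keys p. norm (Poly_Mapping.lookup p m)) * r ^ (total_degree p - 1)"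
proof -
  let ?c = "Poly_Mapping.lookup p" and ?K = "Poly_Mapping.keys p" and ?d = "total_degree p"
  have scale: "r *\<^sub>R z = of_real r *s z"
    by (simp add: vec_eq_iff complex_eq_iff)
  have "leading_form p z = (\<Sum>m\<in>?K. if monomial_degree m = ?d then ?c m * monomial_fun m z else 0)"
    unfolding leading_form_def by (subst sum.inter_filter[symmetric]) auto
  note eq = this
  have "poly_fun p (r *\<^sub>R z) - r ^ ?d *\<^sub>R leading_form p z
      = (\<Sum>m\<in>?K. if monomial_degree m = ?d then 0 else ?c m * monomial_fun m (r *\<^sub>R z))"
    unfolding poly_fun_eq eq scale scaleR_sum_right sum_subtractf[symmetric]
    by (auto intro!: sum.cong simp: monomial_fun_smult scaleR_conv_of_real)
  also have "norm \<dots> \<le> (\<Sum>m\<in>?K. norm (?c m) * r ^ (?d - 1))"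
  proof (rule sum_norm_le)
    fix m assume m: "m \<in> ?K"
    show "norm (if monomial_degree m = ?d then 0 else ?c m * monomial_fun m (r *\<^sub>R z))
        \<le> norm (?c m) * r ^ (?d - 1)"
    proof (cases "monomial_degree m = ?d")
      case False
      then have "monomial_degree m \<le> ?d - 1" using monomial_degree_le[OF m] by simp
      then have "r ^ monomial_degree m * norm (monomial_fun m z) \<le> r ^ (?d - 1) * 1"
        using assms by (intro mult_mono power_increasing norm_monomial_fun_le) auto
      then show ?thesis using False assms
        by (simp add: scale monomial_fun_smult norm_mult norm_power mult_left_mono)
    qed (use assms in simp)
  qed
  finally show ?thesis by (simp add: sum_distrib_right)
qed

section \<open>Growth of the characteristic\<close>

lemma log_plus_norm_exp: "log_plus (norm (exp w)) = max 0 (Re w)"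
  by (auto simp: log_plus_def max_def)

lemma nev_char_exp_poly_bounds:
  fixes h :: "('n::finite) cpoly"
  assumes d: "total_degree h > 0"
  obtains a b R :: real where "a > 0"
    "\<And>r. r \<ge> R \<Longrightarrow> a * r ^ total_degree h \<le> nev_char r (\<lambda>z. exp (poly_fun h z))"
    "\<And>r. r \<ge> R \<Longrightarrow> nev_char r (\<lambda>z. exp (poly_fun h z)) \<le> b * r ^ total_degree h"
proof -
  let ?P = "poly_fun h" and ?d = "total_degree h" and ?B = "cball 0 1 :: (complex ^ 'n) set"
  define C where "C = (\<Sum>m\<in>Poly_Mapping.keys h. norm (Poly_Mapping.lookup h m))"
  have C: "C \<ge> 0" unfolding C_def by (intro sum_nonneg) auto
  have P [measurable]: "?P \<in> borel_measurable borel"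
    by (rule borel_measurable_continuous_onI) (rule continuous_on_poly_fun)
  obtain K :: real where K: "K > 0" "\<And>r f :: complex ^ 'n \<Rightarrow> complex.
      r > 0 \<Longrightarrow> (\<lambda>z. log_plus (norm (f z))) \<in> borel_measurable borel \<Longrightarrow>
      nev_char r f = K * (LINT y|lborel. indicator ?B y * log_plus (norm (f ((r / norm y) *\<^sub>R y))))"
    by (rule nev_char_eq) (erule that, blast)
  define g where "g r y = indicator ?B y * max 0 (Re (?P ((r / norm y) *\<^sub>R y)))" for r y
  have N: "nev_char r (\<lambda>z. exp (?P z)) = K * integral\<^sup>L lborel (g r)" if "r \<ge> 1" for r
    using that K(2)[of r "\<lambda>z. exp (?P z)"] unfolding log_plus_norm_exp g_def by simp
  have sphere: "(r / norm y) *\<^sub>R y = r *\<^sub>R (y /\<^sub>R norm y)" for r and y :: "complex ^ 'n"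
    by (simp add: divide_inverse)
  have up: "g r y \<le> indicator ?B y * (C * r ^ ?d)" if "r \<ge> 1" "y \<noteq> 0" for r y
  proof -
    have "Re (?P ((r / norm y) *\<^sub>R y)) \<le> norm (?P ((r / norm y) *\<^sub>R y))"
      by (rule complex_Re_le_cmod)
    also have "\<dots> \<le> C * r ^ ?d"
      unfolding sphere C_def by (rule norm_poly_fun_le) (use that in auto)
    finally show ?thesis using C that
      by (auto simp: g_def indicator_def)
  qed
  have ball: "(\<lambda>y. indicator ?B y :: real) \<in> borel_measurable borel" "emeasure lborel ?B < \<infinity>"
    by (intro borel_measurable_indicator, simp) (rule emeasure_lborel_cball_finite)
  note [measurable] = ball(1)
  have [measurable]: "g r \<in> borel_measurable borel" for r
    unfolding g_def by measurable
  have g0: "g r y \<ge> 0" for r y by (simp add: g_def indicator_def)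
  have int_up: "integrable lborel (\<lambda>y. indicator ?B y * (C * r ^ ?d))" for r
    using ball by (intro integrable_mult_left integrable_real_indicator) auto
  \<comment> \<open>The bounds concern the unit vector in direction y, so the origin has to be
    removed.\<close>
  have AE0: "AE y in lborel. y \<noteq> (0 :: complex ^ 'n)" by (rule AE_lborel_singleton)
  have int_g: "integrable lborel (g r)" if "r \<ge> 1" for r
  proof (rule Bochner_Integration.integrable_bound[OF int_up[of r]])
    show "AE y in lborel. norm (g r y) \<le> norm (indicator ?B y * (C * r ^ ?d))"
      using AE0 
    proof eventually_elim
      case (elim y)
      then show ?case using up[OF that elim] g0[of r y] by simp
    qed
  qed simp
  have upper: "nev_char r (\<lambda>z. exp (?P z)) \<le> (K * (measure lborel ?B * C)) * r ^ ?d" if "r \<ge> 1" for r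
  proof -
    have "integral\<^sup>L lborel (g r) \<le> (LINT y|lborel. indicator ?B y * (C * r ^ ?d))"
      using AE0 by (intro integral_mono_AE int_g int_up that) (auto elim!: eventually_mono intro: up[OF that])
    also have "\<dots> = measure lborel ?B * (C * r ^ ?d)"
      by simp
    finally show ?thesis using K(1) by (simp add: N[OF that] mult.assoc)
  qed

  obtain z0 :: "complex ^ 'n" where z0: "z0 \<noteq> 0" "Re (leading_form h z0) > 0"
    by (rule leading_form_pos_exists[OF d])
  define q where "q y = Re (leading_form h (y /\<^sub>R norm y))" for y
  \<comment> \<open>Rescaled to norm 1/2, so that the point lies inside the open unit ball.\<close>
  define y0 where "y0 = z0 /\<^sub>R (2 * norm z0)"
  have "y0 /\<^sub>R norm y0 = of_real (inverse (norm z0)) *s z0"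
    using z0 by (simp add: y0_def vec_eq_iff scaleR_conv_of_real[of _ "_ :: complex"])
  then have "leading_form h (y0 /\<^sub>R norm y0) = of_real (inverse (norm z0) ^ ?d) * leading_form h z0"
    by (simp only: leading_form_smult of_real_power)
  then have q0: "q y0 > 0" using z0 by (simp add: q_def)
  \<comment> \<open>With this choice \<open>q y0\<close> exceeds the threshold
    \<open>2 * \<delta>\<close> of \<open>U\<close>; on \<open>U\<close> one \<delta> is given up to
    the lower-order terms and one remains.\<close>
  define \<delta> where "\<delta> = q y0 / 4"
  have \<delta>: "\<delta> > 0" using q0 by (simp add: \<delta>_def)
  define U where "U = {y \<in> ball 0 1 - {0}. q y > 2 * \<delta>}"
  have cont: "continuous_on (ball 0 1 - {0}) q"
    unfolding q_def by (intro continuous_intros) auto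
  have "open U"
    using continuous_open_preimage[OF cont, of "{2 * \<delta><..}"]
    by (simp add: U_def vimage_def Int_def conj_ac open_Diff)
  have "y0 \<in> U"
    using z0 q0 by (simp add: U_def y0_def[symmetric] \<delta>_def) (simp add: y0_def)
  have U: "U \<subseteq> ?B" "0 \<notin> U" by (auto simp: U_def)
  have U_fin: "emeasure lborel U < \<infinity>"
    using emeasure_mono[OF U(1), of lborel] ball(2) by (simp add: order_le_less_trans)
  have "emeasure lborel U \<noteq> 0"
    using open_not_negligible[OF \<open>open U\<close>] \<open>y0 \<in> U\<close> \<open>open U\<close>
      negligible_iff_emeasure0[of U] by auto
  then have mU: "measure lborel U > 0"
    using U_fin by (simp add: measure_def enn2real_positive_iff zero_less_iff_neq_zero)
  \<comment> \<open>From here on \<open>C * r ^ (d - 1)\<close> is at most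
    \<open>\<delta> * r ^ d\<close>, where d is the total degree; the 1 makes powers of r monotone
    in the exponent.\<close>
  define R where "R = max 1 (C / \<delta>)"
  \<comment> \<open>Off \<open>U\<close> the claim is just \<open>g r y \<ge> 0\<close>: since log^+
    is nonnegative, the rest of the ball cannot offset the contribution of \<open>U\<close>.\<close>
  have low: "indicator U y * (\<delta> * r ^ ?d) \<le> g r y" if r: "r \<ge> R" for r y
  proof (cases "y \<in> U")
    case True
    have r1: "r \<ge> 1" "C \<le> \<delta> * r" using r \<delta> by (auto simp: R_def field_simps)
    have y: "y \<noteq> 0" "q y > 2 * \<delta>" "y \<in> ?B" using True U by (auto simp: U_def)
    let ?x = "y /\<^sub>R norm y"
    have "\<bar>Re (?P (r *\<^sub>R ?x) - r ^ ?d *\<^sub>R leading_form h ?x)\<bar>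
        \<le> norm (?P (r *\<^sub>R ?x) - r ^ ?d *\<^sub>R leading_form h ?x)"
      by (rule abs_Re_le_cmod)
    also have "\<dots> \<le> C * r ^ (?d - 1)"
      unfolding C_def by (rule norm_poly_fun_minus_leading_form_le) (use y r1 in auto)
    also have "\<dots> \<le> \<delta> * r * r ^ (?d - 1)"
      using r1 by (intro mult_right_mono) auto
    also have "\<dots> = \<delta> * r ^ ?d"
      using d by (simp add: power_eq_if)
    finally have "Re (?P (r *\<^sub>R ?x)) \<ge> r ^ ?d * q y - \<delta> * r ^ ?d"
      by (simp add: q_def)
    moreover have "r ^ ?d * q y \<ge> r ^ ?d * (2 * \<delta>)"
      using y r1 by (intro mult_left_mono) auto
    ultimately have "Re (?P (r *\<^sub>R ?x)) \<ge> \<delta> * r ^ ?d" by (simp add: algebra_simps)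
    then show ?thesis using True y by (simp add: g_def sphere)
  qed (use g0 in simp)
  have lower: "(K * (measure lborel U * \<delta>)) * r ^ ?d \<le> nev_char r (\<lambda>z. exp (?P z))" if r: "r \<ge> R" for r
  proof -
    have r1: "r \<ge> 1" using r by (simp add: R_def)
    have "measure lborel U * (\<delta> * r ^ ?d) = (LINT y|lborel. indicator U y * (\<delta> * r ^ ?d))"
      by simp
    also have "\<dots> \<le> integral\<^sup>L lborel (g r)"
    proof (rule integral_mono)
      show "integrable lborel (\<lambda>y. indicator U y * (\<delta> * r ^ ?d))"
        using U_fin \<open>open U\<close> by (intro integrable_mult_left integrable_real_indicator) auto
    qed (use int_g[OF r1] low[OF r] in auto)
    finally show ?thesis using K(1) by (simp add: N[OF r1] mult.assoc)
  qed
  show thesis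
    by (rule that[of "K * (measure lborel U * \<delta>)" R "K * (measure lborel ?B * C)"])
      (use lower upper K(1) mU \<delta> in \<open>auto simp: R_def\<close>)
qed

section \<open>From power bounds to the order\<close>

text \<open>The quotient ln(c r^d) / ln r equals d + ln c / ln r, so both bounding functions have
  the same limit whatever their constants.\<close>

lemma log_plus_over_ln_tendsto:
  fixes T :: "real \<Rightarrow> real"
  assumes "a > 0" "\<And>r. r \<ge> R \<Longrightarrow> a * r ^ d \<le> T r" "\<And>r. r \<ge> R \<Longrightarrow> T r \<le> b * r ^ d" and "d > 0"
  shows "((\<lambda>r. log_plus (T r) / ln r) \<longlongrightarrow> real d) at_top"
proof (rule tendsto_sandwich)
  \<comment> \<open>Once the lower bound exceeds 1, the truncation in \<open>log_plus\<close> is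
    inactive.\<close>
  have "filterlim (\<lambda>r::real. a * r ^ d) at_top at_top"
    using assms by (intro filterlim_tendsto_pos_mult_at_top[OF tendsto_const] filterlim_pow_at_top filterlim_ident) auto
  then have ev: "eventually (\<lambda>r. a * r ^ d \<ge> 1) at_top"
    by (simp add: filterlim_at_top)
  have aux: "((\<lambda>r. ln c / ln r + real d) \<longlongrightarrow> real d) at_top" for c :: real
  proof -
    have "((\<lambda>r. ln c / ln r) \<longlongrightarrow> 0) at_top"
      by (intro tendsto_divide_0[OF tendsto_const] filterlim_at_top_imp_at_infinity ln_at_top)
    from tendsto_add[OF this tendsto_const[of "real d"]] show ?thesis by simp
  qed
  show "((\<lambda>r. ln a / ln r + real d) \<longlongrightarrow> real d) at_top" "((\<lambda>r. ln b / ln r + real d) \<longlongrightarrow> real d) at_top"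
    by (rule aux)+
  have *: "ln a / ln r + real d \<le> log_plus (T r) / ln r \<and> log_plus (T r) / ln r \<le> ln b / ln r + real d"
    if r: "r \<ge> R" "r > 1" "a * r ^ d \<ge> 1" for r
  proof -
    have T: "a * r ^ d \<le> T r" "T r \<le> b * r ^ d" "T r \<ge> 1" using assms r by fastforce+
    \<comment> \<open>Positivity of \<open>b\<close> is forced by 1 \<le> T r \<le> b r^d, and the
      logarithm of the upper bound can then be split.\<close>
    have b: "b > 0" using T r by (smt (verit) mult_nonpos_nonneg zero_le_power)
    have l: "log_plus (T r) = ln (T r)" using T by (simp add: log_plus_def)
    have "ln (c * r ^ d) / ln r = ln c / ln r + real d" if "c > 0" for c
      using that r by (simp add: ln_mult ln_realpow add_divide_distrib)
    moreover have "ln (a * r ^ d) / ln r \<le> ln (T r) / ln r" "ln (T r) / ln r \<le> ln (b * r ^ d) / ln r"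
      using T r b assms(1) by (auto intro!: divide_right_mono)
    ultimately show ?thesis using l b assms(1) by simp
  qed
  have "eventually (\<lambda>r. ln a / ln r + real d \<le> log_plus (T r) / ln r \<and>
      log_plus (T r) / ln r \<le> ln b / ln r + real d) at_top"
    using ev eventually_ge_at_top[of R] eventually_gt_at_top[of 1] by eventually_elim (rule *)
  then show "eventually (\<lambda>r. ln a / ln r + real d \<le> log_plus (T r) / ln r) at_top"
    "eventually (\<lambda>r. log_plus (T r) / ln r \<le> ln b / ln r + real d) at_top"
    by (auto elim: eventually_mono)
qed

theorem proposition2p3:
  fixes h :: "('n::finite) cpoly" and f :: "complex ^ 'n \<Rightarrow> complex"
  assumes "\<not> constant_poly h"
    and "f = (\<lambda>z. exp (poly_fun h z))"
  shows "nev_order f = ereal (real (total_degree h)) \<and>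
         nev_lower_order f = ereal (real (total_degree h))"
proof -
  have d: "total_degree h > 0" by (rule total_degree_pos[OF assms(1)])
  obtain a b R :: real where "a > 0"
    "\<And>r. r \<ge> R \<Longrightarrow> a * r ^ total_degree h \<le> nev_char r (\<lambda>z. exp (poly_fun h z))"
    "\<And>r. r \<ge> R \<Longrightarrow> nev_char r (\<lambda>z. exp (poly_fun h z)) \<le> b * r ^ total_degree h"
    by (rule nev_char_exp_poly_bounds[OF d]) (erule that; blast)
  then have "((\<lambda>r. log_plus (nev_char r f) / ln r) \<longlongrightarrow> real (total_degree h)) at_top"
    unfolding assms(2) using d by (intro log_plus_over_ln_tendsto)
  then have lim: "((\<lambda>r. ereal (log_plus (nev_char r f) / ln r)) \<longlongrightarrow> ereal (real (total_degree h))) at_top"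
    by simp
  \<comment> \<open>The full limit exists, so upper and lower limit coincide with it.\<close>
  show ?thesis
    unfolding nev_order_def nev_lower_order_def
    using lim_imp_Limsup[OF _ lim] lim_imp_Liminf[OF _ lim] by simp
qed

end
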